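(* Let $G=(V,E)$ be any finite graph with $n$ vertices, $m$ edges and $c$ connected components. Let $T_G(x,y)=\sum_{i,j}t_{ij}x^iy^j$ be the Tutte polynomial of $G$. Then for every integer $h\geq 0$, $$\sum_{i=0}^h\sum_{j=0}^{h-i}\binom{h-i}{j}(-1)^jt_{ij}=(-1)^{m-n+c}\binom{h-n+c}{h-m},$$ where, when $h<m$, the binomial coefficient $\binom{h-n+c}{h-m}$ is interpreted as $0$.
   Context: Graphs are finite; loops and multiple edges are allowed. For a graph $G=(V,E)$ with $v(G)=|V|$ vertices, the Tutte polynomial is $$T_G(x,y)=\sum_{A\subseteq E}(x-1)^{k(A)-k(E)}(y-1)^{k(A)+|A|-v(G)},$$ where for $A\subseteq E$, $k(A)$ denotes the number of connected components of the graph $(V,A)$ (so $k(E)=c$). All exponents are nonnegative integers, so $T_G$ is a polynomial in $x,y$; $t_{ij}$ denotes the coefficient of $x^iy^j$ in it (equal to $0$ if the monomial does not occur). *)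

theory Defs
  imports "HOL-Computational_Algebra.Polynomial"
begin

text \<open>
  Undirected graphs with loops and parallel edges: edges have an identity of their own, and
  \<open>ends e\<close> is the set of endpoints of \<open>e\<close>. It is a singleton exactly when \<open>e\<close> is a loop.
\<close>

record ('v, 'e) multigraph =
  verts :: "'v set"
  edges :: "'e set"
  ends :: "'e \<Rightarrow> 'v set"

definition finite_multigraph :: "('v, 'e) multigraph \<Rightarrow> bool" where
  "finite_multigraph G \<longleftrightarrow>
     finite (verts G) \<and> finite (edges G) \<and>
     (\<forall>e \<in> edges G. \<exists>u \<in> verts G. \<exists>v \<in> verts G. ends G e = {u, v})"

definition adjacency :: "('v, 'e) multigraph \<Rightarrow> ('v \<times> 'v) set" where
  "adjacency G = {(u, v). \<exists>e \<in> edges G. ends G e = {u, v}}"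

definition connectivity :: "('v, 'e) multigraph \<Rightarrow> ('v \<times> 'v) set" where
  "connectivity G = (adjacency G)\<^sup>* \<inter> verts G \<times> verts G"

definition conn_components :: "('v, 'e) multigraph \<Rightarrow> 'v set set" where
  "conn_components G = verts G // connectivity G"

definition spanning_subgraph :: "('v, 'e) multigraph \<Rightarrow> 'e set \<Rightarrow> ('v, 'e) multigraph" where
  "spanning_subgraph G A = G\<lparr>edges := A\<rparr>"

definition num_components :: "('v, 'e) multigraph \<Rightarrow> 'e set \<Rightarrow> nat" where
  "num_components G A = card (conn_components (spanning_subgraph G A))"

text \<open>
  Bivariate integer polynomials are polynomials in \<open>x\<close> whose coefficients are polynomials in \<open>y\<close>.
\<close>

definition var_x :: "int poly poly" where
  "var_x = [:0, 1:]"

definition var_y :: "int poly poly" where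
  "var_y = [:[:0, 1:]:]"

text \<open>
  The subtractions in the exponents are on natural numbers. They do not truncate for a finite
  graph: deleting edges never decreases the number of components, and a graph with vertex set
  \<open>V\<close> and edge set \<open>A\<close> has at least \<open>card V - card A\<close> components.
\<close>

definition tutte_poly :: "('v, 'e) multigraph \<Rightarrow> int poly poly" where
  "tutte_poly G =
     (\<Sum>A \<in> Pow (edges G).
        (var_x - 1) ^ (num_components G A - num_components G (edges G)) *
        (var_y - 1) ^ (num_components G A + card A - card (verts G)))"

definition tutte_coeff :: "('v, 'e) multigraph \<Rightarrow> nat \<Rightarrow> nat \<Rightarrow> int" where
  "tutte_coeff G i j = coeff (coeff (tutte_poly G) i) j"

end

theory Submission
  imports Defs "HOL-Computational_Algebra.Formal_Power_Series"
begin

text \<open>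
  Since \<open>\<Sum>\<^sub>r (r choose j) s\<^sup>r = s\<^sup>j / (1 - s)\<^sup>j\<^sup>+\<^sup>1\<close>, the left-hand side is the coefficient of \<open>s\<^sup>h\<close>
  in \<open>T\<^sub>G(x, y) / (1 - s)\<close> with \<open>x = s\<close> and \<open>y = - s / (1 - s)\<close>. This point lies on the hyperbola
  \<open>(x - 1) (y - 1) = 1\<close>, where \<open>T\<^sub>G\<close> equals \<open>(x - 1)\<^sup>n\<^sup>-\<^sup>c\<^sup>-\<^sup>m x\<^sup>m\<close>. Hence the generating function is
  \<open>(-1)\<^sup>m\<^sup>-\<^sup>n\<^sup>+\<^sup>c s\<^sup>m / (1 - s)\<^sup>m\<^sup>-\<^sup>n\<^sup>+\<^sup>c\<^sup>+\<^sup>1\<close>.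
\<close>

unbundle fps_syntax

section \<open>Evaluation of bivariate polynomials\<close>

lemma poly_map_poly_add:
  assumes "f 0 = 0" and "\<And>a b. f (a + b) = f a + f b"
  shows "poly (map_poly f (p + q)) z = poly (map_poly f p) z + poly (map_poly f q) z"
proof -
  have "map_poly f (p + q) = map_poly f p + map_poly f q"
    by (intro poly_eqI) (simp add: coeff_map_poly assms)
  then show ?thesis by simp
qed

lemma poly_map_poly_mult:
  fixes f :: "'a::comm_ring_1 \<Rightarrow> 'b::comm_ring_1"
  assumes f: "f 0 = 0" "\<And>a b. f (a + b) = f a + f b" "\<And>a b. f (a * b) = f a * f b"
  shows "poly (map_poly f (p * q)) z = poly (map_poly f p) z * poly (map_poly f q) z"
proof (induction p)
  case 0
  then show ?case by simp
next
  case (pCons a p)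
  have "map_poly f (smult a q) = smult (f a) (map_poly f q)"
    by (intro poly_eqI) (simp add: coeff_map_poly f)
  with pCons show ?case
    by (simp add: poly_map_poly_add f map_poly_pCons algebra_simps)
qed

text \<open>The target is an arbitrary commutative ring so that power series can be substituted for
  \<open>x\<close> and \<open>y\<close>.\<close>

definition tutte_eval :: "'a::comm_ring_1 \<Rightarrow> 'a \<Rightarrow> int poly poly \<Rightarrow> 'a" where
  "tutte_eval x y p = poly (map_poly (\<lambda>q. poly (map_poly of_int q) y) p) x"

lemma tutte_eval_simps [simp]:
  "tutte_eval x y 0 = 0"
  "tutte_eval x y 1 = 1"
  "tutte_eval x y (p + q) = tutte_eval x y p + tutte_eval x y q"
  "tutte_eval x y (p * q) = tutte_eval x y p * tutte_eval x y q"
  "tutte_eval x y var_x = x"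
  "tutte_eval x y var_y = y"
  unfolding tutte_eval_def var_x_def var_y_def
  by (simp_all add: poly_map_poly_add poly_map_poly_mult map_poly_pCons map_poly_1)

lemma tutte_eval_diff [simp]: "tutte_eval x y (p - q) = tutte_eval x y p - tutte_eval x y q"
  by (metis diff_add_cancel add_diff_cancel_right' tutte_eval_simps(3))

lemma tutte_eval_power [simp]: "tutte_eval x y (p ^ k) = tutte_eval x y p ^ k"
  by (induction k) simp_all

lemma tutte_eval_sum [simp]: "tutte_eval x y (sum p I) = (\<Sum>i\<in>I. tutte_eval x y (p i))"
  by (induction I rule: infinite_finite_induct) simp_all

section \<open>Components of spanning subgraphs\<close>

lemma equiv_connectivity:
  "equiv (verts G) (connectivity G)"
proof (rule equivI)
  have "sym ((adjacency G)\<^sup>*)"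
    by (intro sym_rtrancl symI) (auto simp: adjacency_def insert_commute)
  then show "sym (connectivity G)"
    unfolding connectivity_def by (auto simp: sym_def)
  show "trans (connectivity G)"
    unfolding connectivity_def trans_def by (auto intro: rtrancl_trans)
qed (auto simp: connectivity_def refl_on_def)

lemma equiv_connectivity_subgraph:
  "equiv (verts G) (connectivity (spanning_subgraph G A))"
  using equiv_connectivity[of "spanning_subgraph G A"] by (simp add: spanning_subgraph_def)

lemma num_components_eq:
  "num_components G A = card (verts G // connectivity (spanning_subgraph G A))"
  by (simp add: num_components_def conn_components_def spanning_subgraph_def)

lemma num_components_edges: "num_components G (edges G) = card (conn_components G)"
  by (simp add: num_components_def spanning_subgraph_def)

lemma connectivity_mono:
  assumes "A \<subseteq> B"
  shows "connectivity (spanning_subgraph G A) \<subseteq> connectivity (spanning_subgraph G B)"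
proof -
  have "adjacency (spanning_subgraph G A) \<subseteq> adjacency (spanning_subgraph G B)"
    using assms by (auto simp: adjacency_def spanning_subgraph_def)
  from rtrancl_mono[OF this] show ?thesis
    by (auto simp: connectivity_def spanning_subgraph_def)
qed

lemma finite_quotient_verts:
  "finite (verts G) \<Longrightarrow> finite (verts G // connectivity (spanning_subgraph G A))"
  by (rule finite_quotient) (auto simp: connectivity_def spanning_subgraph_def)

lemma num_components_antimono:
  assumes "finite (verts G)" "A \<subseteq> B"
  shows "num_components G B \<le> num_components G A"
  unfolding num_components_eq
  by (rule finite_refines_card_le)
     (use assms in \<open>simp_all add: finite_quotient_verts connectivity_mono equiv_connectivity_subgraph\<close>)

text \<open>A walk that uses \<open>e\<close> joins each of its two ends to \<open>u\<close> or
  \<open>v\<close> by edges of \<open>A\<close>, so only the classes of \<open>u\<close> and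
  \<open>v\<close> can merge.\<close>

lemma connectivity_insert:
  assumes e: "ends G e = {u, v}" "u \<in> verts G" "v \<in> verts G"
    and xy: "(x, y) \<in> connectivity (spanning_subgraph G (insert e A))"
  defines "R \<equiv> connectivity (spanning_subgraph G A)"
  defines "C \<equiv> R `` {u} \<union> R `` {v}"
  shows "(x, y) \<in> R \<or> x \<in> C \<and> y \<in> C"
proof -
  let ?S = "(adjacency (spanning_subgraph G A))\<^sup>*"
  let ?D = "?S `` {u} \<union> ?S `` {v}"
  have sym: "sym ?S"
    by (intro sym_rtrancl symI) (auto simp: adjacency_def insert_commute)
  have "(x, y) \<in> (adjacency (spanning_subgraph G (insert e A)))\<^sup>*"
    using xy by (simp add: connectivity_def)
  \<comment> \<open>The induction runs over the unrestricted closures; membership in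
    \<open>verts G\<close> is restored afterwards.\<close>
  then have "(x, y) \<in> ?S \<or> x \<in> ?D \<and> y \<in> ?D"
  proof (induction rule: rtrancl_induct)
    case base
    then show ?case by simp
  next
    case (step y z)
    from step.hyps(2) consider "(y, z) \<in> adjacency (spanning_subgraph G A)" | "{y, z} = {u, v}"
      using e(1) by (auto simp: adjacency_def spanning_subgraph_def)
    then show ?case
    proof cases
      case 1
      with step.IH show ?thesis
        by (auto intro: rtrancl.rtrancl_into_rtrancl)
    next
      case 2
      then have "y = u \<and> z = v \<or> y = v \<and> z = u" by (auto simp: doubleton_eq_iff)
      with step.IH sym show ?thesis by (auto dest: symD)
    qed
  qed
  moreover have "x \<in> verts G" "y \<in> verts G"
    using xy by (auto simp: connectivity_def spanning_subgraph_def)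
  ultimately show ?thesis
    using e by (auto simp: C_def R_def connectivity_def spanning_subgraph_def)
qed

text \<open>Send each old class to the new class containing it. Since only the classes of
  \<open>u\<close> and \<open>v\<close> can merge, this is injective once the class of
  \<open>u\<close> is left out.\<close>

lemma num_components_insert:
  assumes fin: "finite (verts G)" and e: "ends G e = {u, v}" "u \<in> verts G" "v \<in> verts G"
  shows "num_components G A \<le> num_components G (insert e A) + 1"
proof -
  define R where "R = connectivity (spanning_subgraph G A)"
  define R' where "R' = connectivity (spanning_subgraph G (insert e A))"
  let ?V = "verts G"
  have eq: "equiv ?V R" "equiv ?V R'" and sub: "R \<subseteq> R'"
    by (simp_all add: R_def R'_def equiv_connectivity_subgraph connectivity_mono subset_insertI)
  have img: "R' `` (R `` {x}) = R' `` {x}" for x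
    using sub eq by (rule refines_equiv_class_eq2)
  have "card (?V // R - {R `` {u}}) \<le> card (?V // R')"
  proof (rule card_inj_on_le)
    show "finite (?V // R')" using fin by (simp add: R'_def finite_quotient_verts)
    show "(``) R' ` (?V // R - {R `` {u}}) \<subseteq> ?V // R'"
      by (auto simp: quotient_def img)
    show "inj_on ((``) R') (?V // R - {R `` {u}})"
    proof (rule inj_onI)
      fix X Y assume X: "X \<in> ?V // R - {R `` {u}}" and Y: "Y \<in> ?V // R - {R `` {u}}"
        and XY: "R' `` X = R' `` Y"
      from X Y obtain x y where x: "X = R `` {x}" "x \<in> ?V" and y: "Y = R `` {y}" "y \<in> ?V"
        by (auto simp: quotient_def)
      with XY have "(x, y) \<in> R'"
        using eq(2) by (simp add: img eq_equiv_class_iff)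
      then have "(x, y) \<in> R \<or> x \<in> R `` {u} \<union> R `` {v} \<and> y \<in> R `` {u} \<union> R `` {v}"
        unfolding R_def R'_def by (rule connectivity_insert[OF e])
      moreover have "(u, x) \<notin> R" "(u, y) \<notin> R"
        using X Y x y equiv_class_eq[OF eq(1)] by auto
      \<comment> \<open>With the class of \<open>u\<close> excluded, the second alternative puts
        both \<open>x\<close> and \<open>y\<close> in the class of \<open>v\<close>.\<close>
      ultimately have "(x, y) \<in> R"
        using eq(1) unfolding equiv_def sym_def trans_def by blast
      then show "X = Y" using x y equiv_class_eq[OF eq(1)] by auto
    qed
  qed
  moreover have "card (?V // R) \<le> card (?V // R - {R `` {u}}) + 1"
    using diff_card_le_card_Diff[of "{R `` {u}}" "?V // R"] by simp
  ultimately show ?thesis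
    by (simp add: num_components_eq R_def R'_def)
qed

lemma num_components_empty:
  "num_components G {} = card (verts G)"
proof -
  have "verts G // connectivity (spanning_subgraph G {}) = (\<lambda>x. {x}) ` verts G"
    by (auto simp: quotient_def connectivity_def adjacency_def spanning_subgraph_def)
  then show ?thesis by (simp add: num_components_eq card_image)
qed

text \<open>Without edges every vertex is its own component, and each added edge lowers the count by
  at most one.\<close>

lemma card_verts_le:
  assumes "finite_multigraph G" "A \<subseteq> edges G"
  shows "card (verts G) \<le> num_components G A + card A"
proof -
  have "finite A" using assms finite_subset by (auto simp: finite_multigraph_def)
  then show ?thesis using assms(2)
  proof (induction A)
    case empty
    then show ?case by (simp add: num_components_empty)
  next
    case (insert e A)
    then obtain u v where "ends G e = {u, v}" "u \<in> verts G" "v \<in> verts G" "finite (verts G)"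
      using assms(1) unfolding finite_multigraph_def by blast
    then have "num_components G A \<le> num_components G (insert e A) + 1"
      by (intro num_components_insert)
    with insert show ?case by simp
  qed
qed

section \<open>The Tutte polynomial on the hyperbola\<close>

lemma sum_Pow_power_card_Diff:
  fixes a :: "'a::comm_ring_1"
  assumes "finite E"
  shows "(\<Sum>A\<in>Pow E. a ^ (card E - card A)) = (1 + a) ^ card E"
proof -
  \<comment> \<open>Expand the product of \<open>1 + a\<close> over \<open>E\<close>;
    \<open>A\<close> collects the factors that contribute \<open>1\<close>.\<close>
  have "(1 + a) ^ card E = (\<Sum>A\<in>Pow E. (\<Prod>_\<in>A. 1) * (\<Prod>_\<in>E - A. a))"
    using prod_add[OF assms, of "\<lambda>_. 1" "\<lambda>_. a"] by simp
  also have "\<dots> = (\<Sum>A\<in>Pow E. a ^ (card E - card A))"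
    using assms by (intro sum.cong) (auto simp: card_Diff_subset finite_subset)
  finally show ?thesis ..
qed

text \<open>As \<open>y - 1\<close> inverts \<open>x - 1\<close>, the extra power turns the term of
  \<open>A\<close> into \<open>(x - 1) ^ (card E - card A)\<close> with \<open>E = edges G\<close>,
  and the binomial theorem sums these. Keeping that power on the left avoids negative
  exponents.\<close>

lemma tutte_eval_hyperbola:
  fixes x y :: "'a::comm_ring_1"
  assumes G: "finite_multigraph G" and xy: "(x - 1) * (y - 1) = 1"
  shows "tutte_eval x y (tutte_poly G) *
           (x - 1) ^ (card (edges G) + card (conn_components G) - card (verts G)) =
         x ^ card (edges G)"
proof -
  let ?E = "edges G" and ?n = "card (verts G)"
  let ?c = "num_components G ?E"
  have fin: "finite ?E" "finite (verts G)"
    using G by (auto simp: finite_multigraph_def)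
  have cancel: "(x - 1) ^ (a + b) * (y - 1) ^ b = (x - 1) ^ a" for a b
    using xy by (simp add: power_add mult.assoc flip: power_mult_distrib)
  have "(x - 1) ^ (num_components G A - ?c) * (y - 1) ^ (num_components G A + card A - ?n) *
          (x - 1) ^ (card ?E + ?c - ?n) = (x - 1) ^ (card ?E - card A)"
    if A: "A \<subseteq> ?E" for A
  proof -
    let ?k = "num_components G A"
    \<comment> \<open>These bounds ensure that none of the natural-number subtractions in the
      exponents truncates.\<close>
    have le: "?c \<le> ?k" "?n \<le> ?k + card A" "?n \<le> ?c + card ?E" "card A \<le> card ?E"
      using G A fin by (auto intro: num_components_antimono card_verts_le card_mono)
    then have eq: "?k - ?c + (card ?E + ?c - ?n) = (card ?E - card A) + (?k + card A - ?n)"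
      by linarith
    have "(x - 1) ^ (?k - ?c) * (y - 1) ^ (?k + card A - ?n) * (x - 1) ^ (card ?E + ?c - ?n) =
        (x - 1) ^ (?k - ?c + (card ?E + ?c - ?n)) * (y - 1) ^ (?k + card A - ?n)"
      by (simp only: power_add mult_ac)
    then show ?thesis by (simp only: eq cancel)
  qed
  then have "tutte_eval x y (tutte_poly G) * (x - 1) ^ (card ?E + ?c - ?n) =
      (\<Sum>A\<in>Pow ?E. (x - 1) ^ (card ?E - card A))"
    by (simp add: tutte_poly_def sum_distrib_right)
  also have "\<dots> = x ^ card ?E"
    using sum_Pow_power_card_Diff[OF fin(1), of "x - 1"] by simp
  finally show ?thesis by (simp add: num_components_edges)
qed

section \<open>Coefficient extraction with the geometric series \<open>1 / (1 - s)\<close>\<close>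

definition geometric_fps :: "int fps" where
  "geometric_fps = Abs_fps (\<lambda>_. 1)"

lemma geometric_fps_mult: "(1 - fps_X) * geometric_fps = 1"
  by (rule fps_ext) (simp add: geometric_fps_def algebra_simps)

text \<open>Multiplying by the geometric series takes partial sums of coefficients, so the induction
  step is the hockey-stick identity.\<close>

lemma geometric_fps_power_nth:
  "geometric_fps ^ Suc k $ r = int ((k + r) choose r)"
proof (induction k arbitrary: r)
  case 0
  then show ?case by (simp add: geometric_fps_def)
next
  case (Suc k)
  have "geometric_fps ^ Suc (Suc k) $ r = (geometric_fps ^ Suc k * geometric_fps) $ r"
    by (simp add: mult_ac)
  also have "\<dots> = (\<Sum>i\<le>r. int ((k + i) choose i))"
    unfolding fps_mult_nth Suc by (simp add: geometric_fps_def atMost_atLeast0)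
  also have "\<dots> = int (Suc k + r choose r)"
    by (simp add: sum_choose_lower flip: of_nat_sum)
  finally show ?case .
qed

lemma geometric_fps_power_shift_nth:
  "(geometric_fps ^ Suc k * fps_X ^ j) $ r = (if r < j then 0 else int ((k + (r - j)) choose (r - j)))"
  by (simp add: fps_X_power_mult_right_nth geometric_fps_power_nth del: power_Suc)

lemma poly_map_poly_as_sum:
  fixes f :: "'a::zero \<Rightarrow> 'b::comm_semiring_1"
  assumes "f 0 = 0" "degree p \<le> d"
  shows "poly (map_poly f p) z = (\<Sum>i\<le>d. f (coeff p i) * z ^ i)"
proof -
  have "degree (map_poly f p) \<le> d"
    using assms by (intro degree_le) (simp add: coeff_map_poly coeff_eq_0)
  then have "poly (map_poly f p) z = (\<Sum>i\<le>d. coeff (map_poly f p) i * z ^ i)"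
    unfolding poly_altdef by (intro sum.mono_neutral_left) (auto simp: coeff_eq_0)
  then show ?thesis by (simp add: coeff_map_poly assms)
qed

text \<open>By linearity it suffices to treat monomials, where the series is
  \<open>(-1)^j s^j / (1 - s)^(j+1)\<close>.\<close>

lemma geometric_eval_nth:
  "(geometric_fps * poly (map_poly of_int q) (- (fps_X * geometric_fps))) $ r =
     (\<Sum>j=0..r. int (r choose j) * (-1) ^ j * coeff q j)"
proof -
  let ?W = geometric_fps
  \<comment> \<open>The bound must cover the degree, to expand \<open>q\<close>, and also
    \<open>r\<close>, to contain the target range; terms with \<open>j > r\<close> vanish with the
    binomial.\<close>
  define d where "d = max (degree q) r"
  have monom: "(?W * (of_int a * (- (fps_X * ?W)) ^ j)) $ r = int (r choose j) * (-1) ^ j * a" for a j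
  proof -
    have "?W * (of_int a * (- (fps_X * ?W)) ^ j) = fps_const (a * (-1) ^ j) * (?W ^ Suc j * fps_X ^ j)"
      by (simp add: power_minus[of "fps_X * ?W"] power_mult_distrib mult_ac
          flip: fps_of_int fps_const_mult fps_const_neg fps_const_power)
    \<comment> \<open>For \<open>j \<le> r\<close> the shifted coefficient is
      \<open>r choose (r - j)\<close>, equal to \<open>r choose j\<close> by symmetry; for
      \<open>r < j\<close> both sides are 0.\<close>
    then show ?thesis
      using binomial_symmetric[of j r] by (simp add: geometric_fps_power_shift_nth del: power_Suc)
  qed
  have "(?W * poly (map_poly of_int q) (- (fps_X * ?W))) $ r =
      (\<Sum>j\<le>d. int (r choose j) * (-1) ^ j * coeff q j)"
    by (subst poly_map_poly_as_sum[of _ _ d])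
       (simp_all add: d_def sum_distrib_left fps_sum_nth monom)
  also have "\<dots> = (\<Sum>j=0..r. int (r choose j) * (-1) ^ j * coeff q j)"
    by (rule sum.mono_neutral_right) (auto simp: d_def)
  finally show ?thesis .
qed

text \<open>Splitting off the constant term in \<open>x\<close> leaves a factor
  \<open>fps_X\<close>, which lowers \<open>h\<close> by one while \<open>i\<close> shifts by one;
  thus \<open>h - i\<close> is preserved.\<close>

lemma geometric_tutte_eval_nth:
  "(geometric_fps * tutte_eval fps_X (- (fps_X * geometric_fps)) p) $ h =
     (\<Sum>i=0..h. \<Sum>j=0..h - i. int ((h - i) choose j) * (-1) ^ j * coeff (coeff p i) j)"
proof (induction p arbitrary: h)
  case 0
  then show ?case by simp
next
  case (pCons q p)
  let ?W = geometric_fps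
  let ?y = "- (fps_X * ?W)"
  have "?W * tutte_eval fps_X ?y (pCons q p) =
      ?W * poly (map_poly of_int q) ?y + fps_X * (?W * tutte_eval fps_X ?y p)"
    by (simp add: tutte_eval_def map_poly_pCons algebra_simps)
  then show ?case
    by (cases h) (simp_all add: geometric_eval_nth pCons.IH sum.atLeast0_atMost_Suc_shift
        del: sum.cl_ivl_Suc fps_mult_nth_0)
qed

section \<open>Comparison of coefficients\<close>

theorem theorem1p2:
  fixes G :: "('v, 'e) multigraph" and n m c h :: nat
  assumes "finite_multigraph G"
    and "n = card (verts G)"
    and "m = card (edges G)"
    and "c = card (conn_components G)"
  shows "(\<Sum>i = 0..h. \<Sum>j = 0..h - i. int ((h - i) choose j) * (-1) ^ j * tutte_coeff G i j) =
         (-1) ^ (m + c - n) * (if h < m then 0 else int ((h + c - n) choose (h - m)))"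
proof -
  let ?W = geometric_fps
  let ?y = "- (fps_X * ?W)"
  let ?N = "m + c - n"
  let ?T = "tutte_eval fps_X ?y (tutte_poly G)"
  have le: "n \<le> m + c"
    using card_verts_le[OF assms(1) order_refl] assms by (simp add: num_components_edges)
  have W: "fps_X * ?W = ?W - 1"
    using geometric_fps_mult by (simp add: algebra_simps)
  have inv: "(fps_X - 1) * (- ?W) = 1"
    using geometric_fps_mult by (simp add: algebra_simps)
  \<comment> \<open>So \<open>fps_X - 1\<close> and \<open>?y - 1\<close> are mutually inverse: the
    point lies on the hyperbola.\<close>
  have "?y - 1 = - ?W" by (simp add: W)
  then have "?T * (fps_X - 1) ^ ?N = fps_X ^ m"
    using tutte_eval_hyperbola[OF assms(1), of fps_X ?y] inv assms by simp
  \<comment> \<open>Multiplying by \<open>(- ?W) ^ ?N\<close> cancels the power of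
    \<open>fps_X - 1\<close>.\<close>
  then have "?T * ((fps_X - 1) * (- ?W)) ^ ?N = fps_X ^ m * (- ?W) ^ ?N"
    by (simp add: power_mult_distrib mult.assoc[symmetric] del: mult_minus_right)
  then have "?T = fps_X ^ m * (- ?W) ^ ?N"
    by (simp only: inv power_one mult_1_right)
  also have "\<dots> = fps_const ((-1) ^ ?N) * (?W ^ ?N * fps_X ^ m)"
    by (simp add: power_minus[of ?W] mult_ac flip: fps_const_neg fps_const_power)
  \<comment> \<open>The factor \<open>?W\<close> of the generating function raises the exponent to
    \<open>Suc ?N\<close>, the form required by the coefficient formula.\<close>
  finally have "?W * ?T = fps_const ((-1) ^ ?N) * (?W ^ Suc ?N * fps_X ^ m)"
    by (simp add: mult_ac)
  then have "(?W * ?T) $ h = (-1) ^ ?N * (if h < m then 0 else int ((?N + (h - m)) choose (h - m)))"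
    by (simp add: geometric_fps_power_shift_nth del: power_Suc)
  \<comment> \<open>With \<open>n \<le> m + c\<close> and \<open>m \<le> h\<close> neither side
    truncates; for \<open>h < m\<close> the factor \<open>fps_X ^ m\<close> already makes the
    coefficient 0.\<close>
  moreover have "?N + (h - m) = h + c - n" if "\<not> h < m"
    using that le by linarith
  ultimately show ?thesis
    by (auto simp: geometric_tutte_eval_nth tutte_coeff_def)
qed

end
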